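(* Let $\mathbb{F}$ be a finite field, $A\subseteq\mathbb{F}$ with $|A|=n$, and let $r,s,k\ge 1$ be integers. Let $\mathcal{A}$ be a partition of $A$ into sets of size $r+1$ and $\mathcal{A}'$ a partition of $A$ into sets of size $s+1$, and assume the two partitions are orthogonal, i.e. $|X\cap Y|\le 1$ for all $X\in\mathcal{A}$, $Y\in\mathcal{A}'$. Assume that $\dim(\mathcal{F}_{\mathcal{A}}^r\cap\mathcal{F}_{\mathcal{A}'}^s)\ge k$, and let $m$ be the smallest integer such that $\dim V_m=k$, where $V_m=\mathcal{F}_{\mathcal{A}}^r\cap\mathcal{F}_{\mathcal{A}'}^s\cap\mathcal{P}_m$. Let $\Phi:\mathbb{F}^k\to V_m$ be an injective linear mapping, write $f_a=\Phi(a)$, and let $\mathcal{C}=\{(f_a(\alpha))_{\alpha\in A}:a\in\mathbb{F}^k\}$. Then $\mathcal{C}$ is an $(n,k,\{r,s\})$ LRC code with minimum distance at least $n-m+1$.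
   Context: For a partition $\mathcal{A}$ of $A$, $\mathbb{F}_{\mathcal{A}}[x]$ denotes the set of polynomials $f\in\mathbb{F}[x]$ with $\deg f<|A|$ that are constant on each block of $\mathcal{A}$. Set $\mathcal{F}_{\mathcal{A}}^r=\bigoplus_{i=0}^{r-1}\mathbb{F}_{\mathcal{A}}[x]\,x^i$ and $\mathcal{F}_{\mathcal{A}'}^s=\bigoplus_{i=0}^{s-1}\mathbb{F}_{\mathcal{A}'}[x]\,x^i$, where products of polynomials are taken modulo $h(x)=\prod_{a\in A}(x-a)$ (so all elements are polynomials of degree less than $n$). $\mathcal{P}_m$ is the space of polynomials of degree less than $m$. An $(n,k,\{r_1,\dots,r_t\})$ LRC code is a code $\mathcal{C}\subseteq\mathbb{F}^n$ of cardinality $|\mathbb{F}|^k$ such that for every coordinate $i$ there exist pairwise disjoint sets $R_{i,1},\dots,R_{i,t}$ of coordinates, none containing $i$, with $|R_{i,j}|=r_j$, such that for codewords $x\in\mathcal{C}$ and each $j=1,\dots,t$ the symbol $x_i$ is a function of $(x_l)_{l\in R_{i,j}}$. *)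

theory Defs
  imports
    "HOL-Analysis.Analysis"
    "HOL-Computational_Algebra.Polynomial"
    "HOL-Library.Disjoint_Sets"
begin

global_interpretation poly_vs: vector_space "smult :: 'a::field \<Rightarrow> 'a poly \<Rightarrow> 'a poly"
  by unfold_locales (simp_all add: smult_add_right smult_add_left)

text \<open>The disjunct \<open>f = 0\<close> is needed because \<^term>\<open>degree (0 :: 'a::zero poly) = 0\<close>.\<close>

definition polys_below :: "nat \<Rightarrow> 'a::field poly set" where
  "polys_below m = {f. f = 0 \<or> degree f < m}"

definition block_constant_polys :: "'a::field set \<Rightarrow> 'a set set \<Rightarrow> 'a poly set" where
  "block_constant_polys A P =
     {f \<in> polys_below (card A). \<forall>X\<in>P. \<forall>\<alpha>\<in>X. \<forall>\<beta>\<in>X. poly f \<alpha> = poly f \<beta>}"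

definition annihilator_poly :: "'a::field set \<Rightarrow> 'a poly" where
  "annihilator_poly A = (\<Prod>a\<in>A. [:- a, 1:])"

text \<open>
  The sum of the spaces \<open>\<F>\<^sub>P[x] x\<^sup>i\<close> for \<open>i < r\<close>, with products reduced modulo
  \<^term>\<open>annihilator_poly A\<close>.  When \<open>P\<close> partitions \<open>A\<close> into blocks of size \<open>r + 1\<close> the sum is
  direct: see \<open>block_poly_space_direct\<close> below.
\<close>

definition block_poly_space :: "'a::field set \<Rightarrow> 'a set set \<Rightarrow> nat \<Rightarrow> 'a poly set" where
  "block_poly_space A P r =
     {\<Sum>i<r. (g i * monom 1 i) mod annihilator_poly A | g.
        \<forall>i<r. g i \<in> block_constant_polys A P}"

lemma poly_mod_annihilator:
  fixes A :: "'a::field set"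
  assumes "finite A" "\<alpha> \<in> A"
  shows "poly (p mod annihilator_poly A) \<alpha> = poly p \<alpha>"
proof -
  have "poly (annihilator_poly A) \<alpha> = 0"
    using assms by (auto simp: annihilator_poly_def poly_prod)
  moreover have "p = p div annihilator_poly A * annihilator_poly A + p mod annihilator_poly A"
    by simp
  ultimately show ?thesis
    by (metis add_0 mult_zero_right poly_add poly_mult)
qed

lemma block_poly_space_direct:
  fixes A :: "'a::field set"
  assumes fin: "finite A" and part: "partition_on A P"
    and size: "\<forall>X\<in>P. card X = r + 1"
    and g: "\<forall>i<r. g i \<in> block_constant_polys A P"
    and zero: "(\<Sum>i<r. (g i * monom 1 i) mod annihilator_poly A) = 0"
    and "i < r"
  shows "g i = 0"
proof -
  have "poly (g i) \<alpha> = 0" if "\<alpha> \<in> A" for \<alpha>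
  proof -
    obtain X where X: "X \<in> P" "\<alpha> \<in> X"
      using part \<open>\<alpha> \<in> A\<close> unfolding partition_on_def by blast
    have XA: "X \<subseteq> A"
      using part X unfolding partition_on_def by blast
    define q where "q = (\<Sum>j<r. monom (poly (g j) \<alpha>) j)"
    have coeff_q: "coeff q j = (if j < r then poly (g j) \<alpha> else 0)" for j
      by (auto simp: q_def coeff_sum if_distrib cong: if_cong)
    have root: "poly q \<beta> = 0" if "\<beta> \<in> X" for \<beta>
    proof -
      have "poly (g j) \<alpha> = poly (g j) \<beta>" if "j < r" for j
        using g X that \<open>\<beta> \<in> X\<close> unfolding block_constant_polys_def by blast
      then have "poly q \<beta> = (\<Sum>j<r. poly (g j * monom 1 j) \<beta>)"
        by (simp add: q_def poly_sum poly_monom)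
      also have "\<dots> = poly (\<Sum>j<r. (g j * monom 1 j) mod annihilator_poly A) \<beta>"
        using XA that fin by (simp add: poly_sum poly_mod_annihilator subset_iff del: poly_mult)
      finally show ?thesis using zero by simp
    qed
    have "q = 0"
    proof (rule ccontr)
      assume "q \<noteq> 0"
      then have "card X \<le> card {x. poly q x = 0}"
        using root by (intro card_mono poly_roots_finite) auto
      also have "\<dots> \<le> degree q"
        using \<open>q \<noteq> 0\<close> by (rule card_poly_roots_bound)
      also have "\<dots> \<le> r"
        by (rule degree_le) (simp add: coeff_q)
      finally show False using size X by auto
    qed
    then show ?thesis
      using coeff_q[of i] \<open>i < r\<close> by simp
  qed
  note vanish = this
  show ?thesis
  proof (rule ccontr)
    assume nz: "g i \<noteq> 0"
    then have "card A \<le> card {x. poly (g i) x = 0}"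
      using vanish by (intro card_mono poly_roots_finite) auto
    also have "\<dots> \<le> degree (g i)"
      using nz by (rule card_poly_roots_bound)
    finally show False
      using g \<open>i < r\<close> nz by (auto simp: block_constant_polys_def polys_below_def)
  qed
qed

definition orthogonal_partitions :: "'a set set \<Rightarrow> 'a set set \<Rightarrow> bool" where
  "orthogonal_partitions P Q \<longleftrightarrow> (\<forall>X\<in>P. \<forall>Y\<in>Q. card (X \<inter> Y) \<le> 1)"

text \<open>
  A word of length \<open>n\<close> is a function in \<open>I \<rightarrow>\<^sub>E UNIV\<close> for an index set \<open>I\<close> of \<open>n\<close> coordinates.
\<close>

definition min_distance :: "'i set \<Rightarrow> ('i \<Rightarrow> 'a) set \<Rightarrow> nat" where
  "min_distance I C = Min {card {i\<in>I. x i \<noteq> y i} | x y. x \<in> C \<and> y \<in> C \<and> x \<noteq> y}"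

text \<open>\<open>S\<close> is a recovering set for coordinate \<open>i\<close>: on the code, the symbol \<open>x\<^sub>i\<close> is a function of
  the restriction of \<open>x\<close> to \<open>S\<close>.\<close>

definition recovers :: "('i \<Rightarrow> 'a) set \<Rightarrow> 'i set \<Rightarrow> 'i \<Rightarrow> bool" where
  "recovers C S i \<longleftrightarrow> (\<exists>\<phi>. \<forall>x\<in>C. x i = \<phi> (restrict x S))"

text \<open>The sizes \<open>r\<^sub>1, \<dots>, r\<^sub>t\<close> form a list since they may coincide; their order is immaterial.\<close>

definition lrc_code :: "'i set \<Rightarrow> nat \<Rightarrow> nat \<Rightarrow> nat list \<Rightarrow> ('i \<Rightarrow> 'a::{field,finite}) set \<Rightarrow> bool" where
  "lrc_code I n k rs C \<longleftrightarrow>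
     finite I \<and> card I = n \<and> C \<subseteq> (I \<rightarrow>\<^sub>E UNIV) \<and> card C = CARD('a) ^ k \<and>
     (\<forall>i\<in>I. \<exists>R :: nat \<Rightarrow> 'i set.
        disjoint_family_on R {..<length rs} \<and>
        (\<forall>j<length rs. R j \<subseteq> I - {i} \<and> card (R j) = rs ! j \<and> recovers C (R j) i))"

end

theory Submission
  imports Defs
begin

text \<open>
  On a block \<open>X\<close> of \<open>P\<close> every member of \<^term>\<open>block_poly_space A P r\<close> coincides with a polynomial
  of degree less than \<open>r\<close>, so its value at \<open>i \<in> X\<close> is determined by its values at the \<open>r\<close> points of
  \<open>X - {i}\<close>. Two blocks of orthogonal partitions that meet in \<open>i\<close> meet only there, which makes the
  two recovering sets disjoint. The distance bound counts the roots of a difference of two encoded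
  polynomials, whose degree is less than \<open>m\<close>.
\<close>

text \<open>The points of agreement are roots of \<open>p - q\<close>, a nonzero polynomial of
  degree less than \<open>m\<close>. This single root count serves both the recovery of a symbol and
  the distance bound.\<close>

lemma card_agree_less:
  assumes "p \<in> polys_below m" "q \<in> polys_below m" "p \<noteq> q"
  shows "card {x\<in>S. poly p x = poly q x} < m"
proof -
  have nz: "p - q \<noteq> 0" using assms by simp
  have "card {x\<in>S. poly p x = poly q x} \<le> card {x. poly (p - q) x = 0}"
    using nz by (intro card_mono poly_roots_finite) auto
  also have "\<dots> \<le> degree (p - q)"
    using nz by (rule card_poly_roots_bound)
  also have "\<dots> < m"
    using assms degree_diff_less[of p m q] by (auto simp: polys_below_def)
  finally show ?thesis .
qed

lemma polys_below_eqI: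
  assumes "p \<in> polys_below m" "q \<in> polys_below m" "m \<le> card S"
    and "\<And>x. x \<in> S \<Longrightarrow> poly p x = poly q x"
  shows "p = q"
proof (rule ccontr)
  assume "p \<noteq> q"
  moreover have "{x\<in>S. poly p x = poly q x} = S" using assms(4) by auto
  ultimately show False using card_agree_less[of p m q S] assms by simp
qed

text \<open>Finiteness of \<open>A\<close> can be left out: for infinite \<open>A\<close> the
  product defaults to 1 and \<open>card A\<close> to 0, so both sides are 0.\<close>

lemma degree_annihilator_poly: "degree (annihilator_poly A) = card A"
  by (simp add: annihilator_poly_def degree_prod_eq_sum_degree)

lemma annihilator_poly_nonzero: "annihilator_poly A \<noteq> 0"
  by (cases "finite A") (simp_all add: annihilator_poly_def)

lemma mod_annihilator_in_polys_below: "p mod annihilator_poly A \<in> polys_below (card A)"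
  using degree_mod_less[OF annihilator_poly_nonzero, of p A]
  by (auto simp: polys_below_def degree_annihilator_poly)

lemma sum_in_polys_below:
  assumes "\<And>i. i \<in> I \<Longrightarrow> f i \<in> polys_below m"
  shows "sum f I \<in> polys_below m"
  using assms
proof (induction I rule: infinite_finite_induct)
  case (insert i I)
  then have "f i \<in> polys_below m" "sum f I \<in> polys_below m" by auto
  then have "f i + sum f I \<in> polys_below m"
    using degree_add_less[of "f i" m "sum f I"] by (auto simp: polys_below_def)
  then show ?case using insert by simp
qed (simp_all add: polys_below_def)

lemma block_poly_space_subset_polys_below: "block_poly_space A P r \<subseteq> polys_below (card A)"
  by (auto simp: block_poly_space_def intro!: sum_in_polys_below mod_annihilator_in_polys_below)

text \<open>Reduction modulo \<open>annihilator_poly A\<close> leaves values on \<open>A\<close>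
  unchanged, and each coefficient \<open>g i\<close> is constant on \<open>X\<close>. Freezing the
  coefficients at one point \<open>a\<close> of \<open>X\<close> therefore turns \<open>f\<close>
  into an ordinary polynomial with \<open>r\<close> coefficients.\<close>

lemma block_poly_space_on_block:
  fixes A :: "'a::field set"
  assumes "finite A" "partition_on A P" "X \<in> P" "f \<in> block_poly_space A P r"
  obtains q where "q \<in> polys_below r" "\<And>x. x \<in> X \<Longrightarrow> poly f x = poly q x"
proof (cases "X = {}")
  case True
  then show ?thesis using that[of 0] by (auto simp: polys_below_def)
next
  case False
  then obtain a where a: "a \<in> X" by auto
  obtain g where f: "f = (\<Sum>i<r. (g i * monom 1 i) mod annihilator_poly A)"
    and g: "\<forall>i<r. g i \<in> block_constant_polys A P"
    using assms by (auto simp: block_poly_space_def)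
  show ?thesis
  proof (rule that)
    show "(\<Sum>i<r. monom (poly (g i) a) i) \<in> polys_below r"
      \<comment> \<open>The inequality \<open>degree_monom_le\<close> is used because a frozen
        coefficient may vanish, and the monomial then has degree 0 instead of
        \<open>i\<close>.\<close>
      by (rule sum_in_polys_below) (auto simp: polys_below_def intro: le_less_trans[OF degree_monom_le])
  next
    fix x assume x: "x \<in> X"
    then have "x \<in> A" using assms by (auto simp: partition_on_def)
    moreover have "poly (g i) x = poly (g i) a" if "i < r" for i
      using g that x a assms unfolding block_constant_polys_def by blast
    ultimately show "poly f x = poly (\<Sum>i<r. monom (poly (g i) a) i) x"
      using assms by (simp add: f poly_sum poly_mod_annihilator poly_monom)
  qed
qed

text \<open>On \<open>X\<close> both functions are given by polynomials of degree less than
  \<open>r\<close>, and the \<open>r\<close> points of \<open>X - {a}\<close> already determine such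
  a polynomial.\<close>

lemma block_poly_space_eq_on_block:
  fixes A :: "'a::field set"
  assumes A: "finite A" "partition_on A P" and X: "X \<in> P" "card X = r + 1" "a \<in> X"
    and f: "f \<in> block_poly_space A P r" and g: "g \<in> block_poly_space A P r"
    and eq: "\<And>x. x \<in> X - {a} \<Longrightarrow> poly f x = poly g x"
  shows "poly f a = poly g a"
proof -
  obtain p where p: "p \<in> polys_below r" "\<And>x. x \<in> X \<Longrightarrow> poly f x = poly p x"
    using block_poly_space_on_block[OF A X(1) f] by blast
  obtain q where q: "q \<in> polys_below r" "\<And>x. x \<in> X \<Longrightarrow> poly g x = poly q x"
    using block_poly_space_on_block[OF A X(1) g] by blast
  have "p = q"
    using p q X eq by (intro polys_below_eqI[of p r q "X - {a}"]) auto
  then show ?thesis using p q X by simp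
qed

text \<open>The decoder picks any codeword with the given restriction to \<open>S\<close> and reads
  off its symbol at \<open>i\<close>. The choice does not matter, since codewords that agree on
  \<open>S\<close> agree at \<open>i\<close>.\<close>

lemma recoversI:
  assumes "\<And>x y. x \<in> C \<Longrightarrow> y \<in> C \<Longrightarrow> (\<And>j. j \<in> S \<Longrightarrow> x j = y j) \<Longrightarrow> x i = y i"
  shows "recovers C S i"
proof -
  define \<phi> where "\<phi> w = (SOME y. y \<in> C \<and> restrict y S = w) i" for w
  have "x i = \<phi> (restrict x S)" if x: "x \<in> C" for x
  proof -
    define y where "y = (SOME y. y \<in> C \<and> restrict y S = restrict x S)"
    have y: "y \<in> C \<and> restrict y S = restrict x S"
      unfolding y_def by (rule someI[of _ x]) (use x in simp)
    have "x i = y i"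
    proof (rule assms[OF x conjunct1[OF y]])
      show "x j = y j" if "j \<in> S" for j
        using fun_cong[OF conjunct2[OF y], of j] that by simp
    qed
    then show ?thesis by (simp only: \<phi>_def y_def)
  qed
  then show ?thesis unfolding recovers_def by blast
qed

lemma recovers_block:
  fixes A :: "'a::field set"
  assumes "finite A" "partition_on A P" "X \<in> P" "card X = r + 1" "a \<in> X"
    and "F \<subseteq> block_poly_space A P r"
  shows "recovers ((\<lambda>f. \<lambda>\<alpha>\<in>A. poly f \<alpha>) ` F) (X - {a}) a"
proof (rule recoversI)
  fix x y
  assume "x \<in> (\<lambda>f. \<lambda>\<alpha>\<in>A. poly f \<alpha>) ` F" "y \<in> (\<lambda>f. \<lambda>\<alpha>\<in>A. poly f \<alpha>) ` F"
    and eq: "\<And>j. j \<in> X - {a} \<Longrightarrow> x j = y j"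
  then obtain f g where fg: "f \<in> F" "g \<in> F" "x = (\<lambda>\<alpha>\<in>A. poly f \<alpha>)" "y = (\<lambda>\<alpha>\<in>A. poly g \<alpha>)"
    by blast
  have XA: "X \<subseteq> A" using assms by (auto simp: partition_on_def)
  have "poly f b = poly g b" if "b \<in> X - {a}" for b
    using eq[OF that] that XA by (auto simp: fg)
  then have "poly f a = poly g a"
    using assms fg by (intro block_poly_space_eq_on_block[of A P X r a f g]) auto
  then show "x a = y a" by (simp add: fg)
qed

lemma orthogonal_partitions_Int:
  assumes "orthogonal_partitions P Q" "X \<in> P" "Y \<in> Q" "finite X" "a \<in> X" "a \<in> Y"
  shows "X \<inter> Y = {a}"
proof -
  have "card (X \<inter> Y) \<le> Suc 0" using assms by (auto simp: orthogonal_partitions_def)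
  then have "\<forall>x\<in>X \<inter> Y. \<forall>y\<in>X \<inter> Y. x = y"
    using assms by (simp add: card_le_Suc0_iff_eq)
  then show ?thesis using assms by blast
qed

text \<open>The value of \<open>Min\<close> is meaningful only for a finite nonempty set. Distances
  are at most \<open>card I\<close>, and the distinct words \<open>x\<close> and \<open>y\<close>
  provide one.\<close>

lemma min_distance_ge:
  assumes "finite I" "x \<in> C" "y \<in> C" "x \<noteq> y"
    and "\<And>x y. x \<in> C \<Longrightarrow> y \<in> C \<Longrightarrow> x \<noteq> y \<Longrightarrow> d \<le> card {i\<in>I. x i \<noteq> y i}"
  shows "d \<le> min_distance I C"
proof -
  let ?D = "{card {i\<in>I. x i \<noteq> y i} | x y. x \<in> C \<and> y \<in> C \<and> x \<noteq> y}"
  have "?D \<subseteq> {..card I}" using assms(1) by (auto intro!: card_mono)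
  then have "finite ?D" by (rule finite_subset) simp
  moreover have "?D \<noteq> {}" using assms(2-4) by blast
  ultimately have "Min ?D \<in> ?D" by (rule Min_in)
  then show ?thesis using assms(5) unfolding min_distance_def by auto
qed

text \<open>Split \<open>A\<close> into the points of agreement, fewer than \<open>m\<close>, and
  the rest. Subtraction is truncated, so the bound is trivial once \<open>m\<close> exceeds
  \<open>card A\<close>.\<close>

lemma card_differ_ge:
  fixes A :: "'a::field set"
  assumes "finite A" "f \<in> polys_below m" "g \<in> polys_below m" "f \<noteq> g"
  shows "card A + 1 - m \<le> card {\<alpha>\<in>A. poly f \<alpha> \<noteq> poly g \<alpha>}"
proof -
  have "card A = card {\<alpha>\<in>A. poly f \<alpha> = poly g \<alpha>} + card {\<alpha>\<in>A. poly f \<alpha> \<noteq> poly g \<alpha>}"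
    using assms(1) by (subst card_Un_disjoint[symmetric]) (auto intro!: arg_cong[where f = card])
  with card_agree_less[OF assms(2-4), of A] show ?thesis by linarith
qed

theorem theorem4p1:
  fixes A :: "'a::{field,finite} set"
    and P Q :: "'a set set"
    and n r s k m :: nat
    and V :: "nat \<Rightarrow> 'a poly set"
    and \<Phi> :: "'a ^ 'k \<Rightarrow> 'a poly"
    and C :: "('a \<Rightarrow> 'a) set"
  assumes "card A = n"
    and "r \<ge> 1" and "s \<ge> 1" and "k \<ge> 1" and "CARD('k) = k"
    and "partition_on A P" and "\<forall>X\<in>P. card X = r + 1"
    and "partition_on A Q" and "\<forall>Y\<in>Q. card Y = s + 1"
    and "orthogonal_partitions P Q"
    and "vector_space.dim smult (block_poly_space A P r \<inter> block_poly_space A Q s) \<ge> k"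
    and "\<And>l. V l = block_poly_space A P r \<inter> block_poly_space A Q s \<inter> polys_below l"
    and "m = (LEAST l. vector_space.dim smult (V l) = k)"
    and "Vector_Spaces.linear (*s) smult \<Phi>" and "inj \<Phi>" and "range \<Phi> \<subseteq> V m"
    and "C = range (\<lambda>a. \<lambda>\<alpha>\<in>A. poly (\<Phi> a) \<alpha>)"
  shows "lrc_code A n k [r, s] C \<and> int (min_distance A C) \<ge> int n - int m + 1"
proof -
  let ?E = "\<lambda>f. \<lambda>\<alpha>\<in>A. poly f \<alpha>"
  have fin: "finite A" by simp
  have V: "V m \<subseteq> block_poly_space A P r" "V m \<subseteq> block_poly_space A Q s" "V m \<subseteq> polys_below m"
    using assms(12) by auto
  have C_eq: "C = ?E ` range \<Phi>" using assms(17) by auto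
  \<comment> \<open>Members of the space have degree less than \<open>card A\<close>, so their
    values on \<open>A\<close> determine them. Encoding thus loses no message, which gives the
    cardinality of \<open>C\<close>.\<close>
  have inj_E: "inj_on ?E (block_poly_space A P r)"
  proof (rule inj_onI)
    fix f g assume fg: "f \<in> block_poly_space A P r" "g \<in> block_poly_space A P r" "?E f = ?E g"
    show "f = g"
    proof (rule polys_below_eqI)
      show "f \<in> polys_below (card A)" "g \<in> polys_below (card A)"
        using fg(1,2) block_poly_space_subset_polys_below by blast+
      show "poly f \<alpha> = poly g \<alpha>" if "\<alpha> \<in> A" for \<alpha>
        using fun_cong[OF fg(3), of \<alpha>] that by simp
    qed simp
  qed
  have inj_C: "inj_on ?E (range \<Phi>)"
    using inj_E assms(16) V(1) by (rule inj_on_subset[OF _ subset_trans])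
  have card_C: "card C = CARD('a) ^ k"
    unfolding C_eq card_image[OF inj_C] card_image[OF \<open>inj \<Phi>\<close>] using assms(5) by simp
  have lrc: "lrc_code A n k [r, s] C"
    unfolding lrc_code_def
  proof (intro conjI ballI)
    show "C \<subseteq> A \<rightarrow>\<^sub>E UNIV" using C_eq by auto
  next
    fix a assume a: "a \<in> A"
    obtain X where X: "X \<in> P" "a \<in> X" using a assms(6) by (auto simp: partition_on_def)
    obtain Y where Y: "Y \<in> Q" "a \<in> Y" using a assms(8) by (auto simp: partition_on_def)
    have XY: "X \<inter> Y = {a}"
      using orthogonal_partitions_Int[OF assms(10)] X Y by simp
    have sub: "X \<subseteq> A" "Y \<subseteq> A" using X Y assms(6,8) by (auto simp: partition_on_def)
    have recX: "recovers C (X - {a}) a"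
      unfolding C_eq using assms X V by (intro recovers_block[of A P X r]) auto
    have recY: "recovers C (Y - {a}) a"
      unfolding C_eq using assms Y V by (intro recovers_block[of A Q Y s]) auto
    \<comment> \<open>Index 0 gives the set of size \<open>r\<close> and index 1 the set of size
      \<open>s\<close>. They are disjoint because \<open>X\<close> and \<open>Y\<close> share only
      \<open>a\<close>, which is removed from both.\<close>
    let ?R = "\<lambda>j :: nat. if j = 0 then X - {a} else Y - {a}"
    have card_R: "card (X - {a}) = r" "card (Y - {a}) = s"
      using X Y assms(7,9) by simp_all
    have disj: "disjoint_family_on ?R {..<length [r, s]}"
      using XY unfolding disjoint_family_on_def by auto
    have "?R j \<subseteq> A - {a} \<and> card (?R j) = [r, s] ! j \<and> recovers C (?R j) a" if "j < length [r, s]" for j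
    proof (cases "j = 0")
      case True
      then show ?thesis using sub card_R recX by auto
    next
      case False
      with that have "j = 1" by simp
      then show ?thesis using sub card_R recY by auto
    qed
    with disj show "\<exists>R. disjoint_family_on R {..<length [r, s]} \<and>
        (\<forall>j<length [r, s]. R j \<subseteq> A - {a} \<and> card (R j) = [r, s] ! j \<and> recovers C (R j) a)"
      by blast
  qed (use assms(1) card_C in simp_all)
  \<comment> \<open>The index type \<open>'k\<close> is nonempty, so the zero and all-ones messages
    differ. Their encodings are the two distinct codewords that \<open>min_distance_ge\<close> asks
    for.\<close>
  have "0 \<noteq> (1 :: 'a ^ 'k)" by simp
  then have "?E (\<Phi> 0) \<noteq> ?E (\<Phi> 1)"
    using inj_onD[OF inj_C] injD[OF \<open>inj \<Phi>\<close>] by blast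
  moreover have "?E (\<Phi> a) \<in> C" for a unfolding C_eq by (intro imageI rangeI)
  ultimately have "n + 1 - m \<le> min_distance A C"
  proof (intro min_distance_ge[OF fin, of "?E (\<Phi> 0)" C "?E (\<Phi> 1)"])
    fix x y assume xy: "x \<in> C" "y \<in> C" "x \<noteq> y"
    obtain f where f: "x = ?E f" "f \<in> V m" using xy(1) assms(16) unfolding C_eq by blast
    obtain g where g: "y = ?E g" "g \<in> V m" using xy(2) assms(16) unfolding C_eq by blast
    have "f \<noteq> g" using xy(3) f g by blast
    then have "n + 1 - m \<le> card {\<alpha>\<in>A. poly f \<alpha> \<noteq> poly g \<alpha>}"
      using card_differ_ge[OF fin, of f m g] f(2) g(2) V(3) assms(1) by blast
    also have "{\<alpha>\<in>A. poly f \<alpha> \<noteq> poly g \<alpha>} = {\<alpha>\<in>A. x \<alpha> \<noteq> y \<alpha>}"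
      unfolding f g by auto
    finally show "n + 1 - m \<le> card {\<alpha>\<in>A. x \<alpha> \<noteq> y \<alpha>}" .
  qed blast+
  \<comment> \<open>The truncated \<open>n + 1 - m\<close> is at least the integer
    \<open>int n - int m + 1\<close>, which may be negative.\<close>
  with lrc show ?thesis by linarith
qed

end
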